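(* Let $E$ be a complex Hilbert space. If $(x_n)_{n\in\mathbb{N}}\subset B_E\setminus\{0\}$ is an interpolating sequence for $\mathcal{B}(B_E)$, then there exists $\delta>0$ such that every sequence $(y_n)_{n\in\mathbb{N}}\subset B_E$ satisfying $\sup_{n\in\mathbb{N}}\rho_E(x_n,y_n)<\delta$ is also an interpolating sequence for $\mathcal{B}(B_E)$.
   Context: $E$ is a finite or infinite dimensional complex Hilbert space, $B_E$ its open unit ball. The pseudohyperbolic distance $\rho_E(x,y)\in[0,1)$ on $B_E$ is given by $\rho_E(x,y)^2=1-\frac{(1-\|x\|^2)(1-\|y\|^2)}{|1-\langle x,y\rangle|^2}$. For holomorphic (Fréchet differentiable) $f:B_E\to\mathbb{C}$, $\nabla f(x)$ denotes the derivative $f'(x)$, and $\mathcal{R}f(x)=\langle x,\overline{\nabla f(x)}\rangle=f'(x)(x)$ is the radial derivative. The Bloch space $\mathcal{B}(B_E)$ is the set of holomorphic $f:B_E\to\mathbb{C}$ with $\sup_{x\in B_E}(1-\|x\|^2)\|\nabla f(x)\|<\infty$. A sequence $(x_n)\subset B_E\setminus\{0\}$ is interpolating for $\mathcal{B}(B_E)$ if for every bounded sequence $(a_n)$ of complex numbers there exists $f\in\mathcal{B}(B_E)$ such that $(1-\|x_n\|^2)\,\mathcal{R}f(x_n)=a_n$ for all $n$. *)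

theory Defs
  imports "HOL-Analysis.Analysis"
begin

text \<open>
  Complex Hilbert spaces of arbitrary dimension. The inner product is linear in its first
  argument. The real vector space structure inherited from \<^class>\<open>banach\<close> is the restriction of
  the complex one to real scalars, the norm is the one induced by the inner product (the last
  axiom, which also yields positive definiteness), and \<^class>\<open>banach\<close> supplies completeness.
\<close>

class complex_hilbert_space = banach +
  fixes scaleC :: "complex \<Rightarrow> 'a \<Rightarrow> 'a" (infixr "*\<^sub>C" 75)
    and cinner :: "'a \<Rightarrow> 'a \<Rightarrow> complex"
  assumes scaleC_add_right: "c *\<^sub>C (x + y) = c *\<^sub>C x + c *\<^sub>C y"
    and scaleC_add_left: "(c + d) *\<^sub>C x = c *\<^sub>C x + d *\<^sub>C x"
    and scaleC_scaleC: "c *\<^sub>C d *\<^sub>C x = (c * d) *\<^sub>C x"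
    and scaleC_one: "1 *\<^sub>C x = x"
    and scaleC_of_real: "complex_of_real r *\<^sub>C x = r *\<^sub>R x"
    and cinner_add_left: "cinner (x + y) z = cinner x z + cinner y z"
    and cinner_scaleC_left: "cinner (c *\<^sub>C x) y = c * cinner x y"
    and cinner_commute: "cinner y x = cnj (cinner x y)"
    and cinner_same: "cinner x x = complex_of_real ((norm x)\<^sup>2)"

text \<open>
  On the open unit ball the argument of the root lies in \<open>[0, 1)\<close>.
\<close>

definition pseudohyperbolic_dist :: "'a::complex_hilbert_space \<Rightarrow> 'a \<Rightarrow> real" where
  "pseudohyperbolic_dist x y =
     sqrt (1 - (1 - (norm x)\<^sup>2) * (1 - (norm y)\<^sup>2) / (cmod (1 - cinner x y))\<^sup>2)"

text \<open>
  \<open>(f has_derivative D) (at x)\<close> only makes \<open>D\<close> bounded and real linear; holomorphy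
  requires it to be complex linear. Functions on the ball are represented by total functions
  whose values outside the ball are irrelevant.
\<close>

definition holomorphic_on_unit_ball :: "('a::complex_hilbert_space \<Rightarrow> complex) \<Rightarrow> bool" where
  "holomorphic_on_unit_ball f \<longleftrightarrow>
     (\<forall>x\<in>ball 0 1. \<exists>D. (f has_derivative D) (at x) \<and> (\<forall>c v. D (c *\<^sub>C v) = c * D v))"

definition bloch_space :: "('a::complex_hilbert_space \<Rightarrow> complex) set" where
  "bloch_space =
     {f. holomorphic_on_unit_ball f \<and>
         bdd_above ((\<lambda>x. (1 - (norm x)\<^sup>2) * onorm (frechet_derivative f (at x))) ` ball 0 1)}"

definition radial_derivative :: "('a::complex_hilbert_space \<Rightarrow> complex) \<Rightarrow> 'a \<Rightarrow> complex" where
  "radial_derivative f x = frechet_derivative f (at x) x"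

definition bloch_interpolating :: "(nat \<Rightarrow> 'a::complex_hilbert_space) \<Rightarrow> bool" where
  "bloch_interpolating x \<longleftrightarrow>
     range x \<subseteq> ball 0 1 - {0} \<and>
     (\<forall>a :: nat \<Rightarrow> complex. bounded (range a) \<longrightarrow>
        (\<exists>f\<in>bloch_space. \<forall>n.
           complex_of_real (1 - (norm (x n))\<^sup>2) * radial_derivative f (x n) = a n))"

end

theory Submission
  imports Defs "HOL-Complex_Analysis.Cauchy_Integral_Formula"
begin

text \<open>
  Write \<open>d = 1 - \<parallel>x\<parallel>\<^sup>2\<close> and \<open>T\<^sub>x f\<close> for the sequence of weighted radial derivatives of \<open>f\<close> along
  \<open>x\<close>, so that interpolation means that \<open>T\<^sub>x\<close> maps the Bloch space onto the bounded sequences. The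
  argument is that a small perturbation of a surjective operator between Banach spaces is
  surjective.

  The perturbation is small because a Bloch function with bound \<open>M\<close> satisfies
  \<open>\<bar>T\<^sub>x f - T\<^sub>y f\<bar> \<le> 84 \<delta> M\<close> whenever the points of \<open>x\<close> and \<open>y\<close> have pseudohyperbolic distance
  less than a small \<open>\<delta>\<close> (\<open>weighted_radial_derivative_perturbation\<close>). This needs only functions of one complex
  variable. If \<open>x\<close> and \<open>y\<close> are two such points, then \<open>w = y - x\<close> has size at most of order \<open>\<delta> \<surd>d\<close>,
  and its component along \<open>x\<close> is even of order \<open>\<delta> d\<close>. Hence the points \<open>z(t) = x + t w\<close> keep a distance
  comparable to \<open>d\<close> from the sphere for all complex \<open>t\<close> in a disc of radius of order \<open>1/\<delta>\<close>. For
  \<open>\<bar>s\<bar> \<le> d/16\<close> the increment \<open>f(z(t) + s z(t)) - f(z(t))\<close> is bounded by a multiple of \<open>M\<close> on that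
  disc, so by Cauchy's estimate in \<open>t\<close> it changes only by \<open>O(\<delta> M)\<close> between \<open>t = 0\<close> and \<open>t = 1\<close>. Its
  derivative with respect to \<open>s\<close> at 0 is the radial derivative at \<open>z(t)\<close>, and Cauchy's estimate in \<open>s\<close>
  gives \<open>O(\<delta> M/d)\<close> for the difference of the radial derivatives.

  Surjectivity of \<open>T\<^sub>x\<close> yields, by Baire's theorem in the space of bounded sequences, a constant \<open>K\<close>
  such that every sequence in the unit ball is approximated up to \<open>1/4\<close> by some \<open>T\<^sub>x f\<close> with Bloch
  bound \<open>K\<close> (\<open>bloch_interpolating_approximation\<close>). If \<open>84 \<delta> K \<le> 1/4\<close>, the same \<open>f\<close> approximates up
  to \<open>1/2\<close> along \<open>y\<close>. Correcting the error again and again gives a series of Bloch functions with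
  geometrically decreasing bounds, whose sum interpolates exactly
  (\<open>interpolation_by_successive_approximation\<close>).
\<close>

section \<open>Complex inner product spaces\<close>

lemma cinner_scaleC_right: "cinner x (c *\<^sub>C y) = cnj c * cinner x y"
  by (metis cinner_commute cinner_scaleC_left complex_cnj_mult)

lemma cinner_add_right: "cinner x (y + z) = cinner x y + cinner x z"
  by (metis cinner_add_left cinner_commute complex_cnj_add)

lemma norm_scaleC: "norm (c *\<^sub>C x) = cmod c * norm x" for x :: "'a::complex_hilbert_space"
proof -
  have "complex_of_real ((norm (c *\<^sub>C x))\<^sup>2) = c * cnj c * complex_of_real ((norm x)\<^sup>2)"
    by (metis cinner_same cinner_scaleC_left cinner_scaleC_right mult.assoc)
  also have "\<dots> = complex_of_real ((cmod c * norm x)\<^sup>2)"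
    by (simp add: complex_norm_square[symmetric] power_mult_distrib del: of_real_power)
  finally have "(norm (c *\<^sub>C x))\<^sup>2 = (cmod c * norm x)\<^sup>2"
    using of_real_eq_iff by blast
  then show ?thesis
    by (metis mult_nonneg_nonneg norm_ge_zero power2_eq_iff_nonneg)
qed

lemma norm_add_scaleC_square:
  fixes x w :: "'a::complex_hilbert_space"
  shows "(norm (x + t *\<^sub>C w))\<^sup>2 = (norm x)\<^sup>2 + 2 * Re (t * cinner w x) + (cmod t * norm w)\<^sup>2"
proof -
  have "complex_of_real ((norm (x + t *\<^sub>C w))\<^sup>2)
      = cinner x x + cinner x (t *\<^sub>C w) + (cinner (t *\<^sub>C w) x + cinner (t *\<^sub>C w) (t *\<^sub>C w))"
    by (simp add: cinner_same[symmetric] cinner_add_left cinner_add_right del: of_real_power)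
  also have "\<dots> = complex_of_real ((norm x)\<^sup>2) + complex_of_real ((cmod t * norm w)\<^sup>2)
      + (t * cinner w x + cnj (t * cinner w x))"
    by (simp add: cinner_same norm_scaleC cinner_scaleC_left cinner_scaleC_right
        cinner_commute[of w x] del: of_real_power of_real_mult)
  finally show ?thesis
    unfolding complex_add_cnj of_real_add[symmetric] of_real_eq_iff by simp
qed

lemma bounded_linear_scaleC_left: "bounded_linear (\<lambda>c. c *\<^sub>C (x :: 'a::complex_hilbert_space))"
proof (rule bounded_linear_intro)
  show "(r *\<^sub>R c) *\<^sub>C x = r *\<^sub>R c *\<^sub>C x" for r c
    by (metis scaleC_of_real scaleC_scaleC scaleR_conv_of_real)
  show "norm (c *\<^sub>C x) \<le> norm c * norm x" for c
    by (simp add: norm_scaleC)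
qed (rule scaleC_add_left)

section \<open>Pseudohyperbolically close points\<close>

text \<open>
  With \<open>a = \<langle>w, x\<rangle>\<close> the definition of the distance becomes the identity
  \<open>\<rho>\<^sup>2 \<bar>d - a\<bar>\<^sup>2 = \<bar>a\<bar>\<^sup>2 + d \<parallel>w\<parallel>\<^sup>2\<close>, and each summand on the right is bounded by the left-hand side.
  The two bounds reflect the shape of a pseudohyperbolic ball: it is an ellipsoid
  whose extent is of order \<open>d\<close> in the direction of its centre and of order \<open>\<surd>d\<close> orthogonally to it.
\<close>

lemma pseudohyperbolic_dist_displacement:
  fixes x y :: "'a::complex_hilbert_space"
  defines "d \<equiv> 1 - (norm x)\<^sup>2" and "w \<equiv> y - x"
  assumes x: "norm x < 1" and \<delta>: "0 < \<delta>" "\<delta> \<le> 1/2"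
    and close: "pseudohyperbolic_dist x y < \<delta>"
  shows "cmod (cinner w x) \<le> 2 * \<delta> * d" and "(norm w)\<^sup>2 \<le> 4 * \<delta>\<^sup>2 * d"
proof -
  define a where "a = cinner w x"
  define q where "q = (cmod (1 - cinner x y))\<^sup>2"
  have d: "0 < d"
    using x unfolding d_def by (simp add: power_less_one_iff)
  have y: "y = x + 1 *\<^sub>C w"
    by (simp add: w_def scaleC_one)
  have "cinner x y = complex_of_real ((norm x)\<^sup>2) + cnj a"
    unfolding y a_def by (simp add: cinner_add_right scaleC_one cinner_same cinner_commute[of w x])
  then have xy: "1 - cinner x y = complex_of_real d - cnj a"
    unfolding d_def by simp
  have q: "q = d\<^sup>2 - 2 * d * Re a + (cmod a)\<^sup>2"
    unfolding q_def xy cmod_power2 by (simp add: power2_eq_square algebra_simps)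
  have dy: "1 - (norm y)\<^sup>2 = d - 2 * Re a - (norm w)\<^sup>2"
    unfolding y norm_add_scaleC_square d_def a_def by simp
  have rho: "1 - d * (1 - (norm y)\<^sup>2) / q < \<delta>\<^sup>2"
    using close \<delta>(1) unfolding pseudohyperbolic_dist_def d_def q_def
    by (metis real_sqrt_less_iff real_sqrt_unique less_eq_real_def)
  \<comment> \<open>A vanishing denominator would give the quotient the value 0, hence distance 1.\<close>
  have "q \<noteq> 0"
  proof
    assume "q = 0"
    then have "1 < \<delta>\<^sup>2" using rho by simp
    moreover have "\<delta>\<^sup>2 \<le> 1" using \<delta> by (simp add: power_le_one)
    ultimately show False by simp
  qed
  then have qpos: "0 < q" unfolding q_def by simp
  have "(cmod a)\<^sup>2 + d * (norm w)\<^sup>2 = q - d * (1 - (norm y)\<^sup>2)"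
    unfolding q dy by (simp add: power2_eq_square algebra_simps)
  also have "\<dots> \<le> \<delta>\<^sup>2 * q"
    using rho qpos by (simp add: field_simps)
  finally have key: "(cmod a)\<^sup>2 + d * (norm w)\<^sup>2 \<le> (\<delta> * cmod (1 - cinner x y))\<^sup>2"
    unfolding q_def power_mult_distrib .
  have sz: "cmod (1 - cinner x y) \<le> d + cmod a"
    unfolding xy using norm_triangle_ineq4[of "complex_of_real d" "cnj a"] d by simp
  have "(cmod a)\<^sup>2 \<le> (\<delta> * cmod (1 - cinner x y))\<^sup>2"
    using key d by (smt (verit) mult_nonneg_nonneg zero_le_power2)
  then have "cmod a \<le> \<delta> * cmod (1 - cinner x y)"
    by (rule power2_le_imp_le) (use \<delta> in simp)
  also have "\<dots> \<le> \<delta> * (d + cmod a)"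
    using sz \<delta> by (intro mult_left_mono) auto
  finally have a1: "cmod a \<le> \<delta> * d + \<delta> * cmod a"
    by (simp add: algebra_simps)
  have "\<delta> * cmod a \<le> 1/2 * cmod a"
    using \<delta> by (intro mult_right_mono) auto
  with a1 show a2: "cmod (cinner w x) \<le> 2 * \<delta> * d"
    unfolding a_def by simp
  have "2 * \<delta> * d \<le> 1 * d"
    using \<delta> d by (intro mult_right_mono) auto
  then have "cmod (1 - cinner x y) \<le> 2 * d"
    using sz a2 unfolding a_def by linarith
  then have "(\<delta> * cmod (1 - cinner x y))\<^sup>2 \<le> (\<delta> * (2 * d))\<^sup>2"
    using \<delta> by (intro power_mono mult_left_mono) auto
  then have "d * (norm w)\<^sup>2 \<le> (\<delta> * (2 * d))\<^sup>2"
    using key zero_le_power2[of "cmod a"] by linarith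
  then have "d * (norm w)\<^sup>2 \<le> d * (4 * \<delta>\<^sup>2 * d)"
    by (simp add: power2_eq_square algebra_simps)
  then show "(norm w)\<^sup>2 \<le> 4 * \<delta>\<^sup>2 * d"
    using d by simp
qed

text \<open>
  On the line \<open>x + t w\<close> the quantity \<open>1 - \<parallel>x\<parallel>\<^sup>2\<close> changes by at most
  \<open>2 \<bar>t\<bar> \<bar>\<langle>w, x\<rangle>\<bar> + \<bar>t\<bar>\<^sup>2 \<parallel>w\<parallel>\<^sup>2\<close>. The radius \<open>1/(8 \<delta>)\<close> makes this at most \<open>d/2 + d/16\<close>.
\<close>

lemma complex_line_defect:
  fixes x w :: "'a::complex_hilbert_space"
  defines "d \<equiv> 1 - (norm x)\<^sup>2"
  assumes d: "0 < d"
    and a: "cmod (cinner w x) \<le> 2 * \<delta> * d" and w: "(norm w)\<^sup>2 \<le> 4 * \<delta>\<^sup>2 * d"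
    and \<delta>: "0 < \<delta>" and t: "cmod t \<le> 1 / (8 * \<delta>)"
  shows "7/16 * d \<le> 1 - (norm (x + t *\<^sub>C w))\<^sup>2"
proof -
  have td: "cmod t * \<delta> \<le> 1/8"
    using t \<delta> by (simp add: field_simps)
  have "Re (t * cinner w x) \<le> cmod t * cmod (cinner w x)"
    by (metis complex_Re_le_cmod norm_mult)
  also have "\<dots> \<le> cmod t * (2 * \<delta> * d)"
    using a by (intro mult_left_mono) auto
  also have "\<dots> = 2 * d * (cmod t * \<delta>)" by simp
  also have "\<dots> \<le> 2 * d * (1/8)"
    using td d by (intro mult_left_mono) auto
  finally have 1: "Re (t * cinner w x) \<le> d/4" by simp
  have "(cmod t * norm w)\<^sup>2 \<le> (cmod t)\<^sup>2 * (4 * \<delta>\<^sup>2 * d)"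
    unfolding power_mult_distrib using w by (intro mult_left_mono) auto
  also have "\<dots> = 4 * d * (cmod t * \<delta>)\<^sup>2"
    by (simp add: power_mult_distrib)
  also have "\<dots> \<le> 4 * d * (1/8)\<^sup>2"
    using td d \<delta> by (intro mult_left_mono power_mono) auto
  finally have 2: "(cmod t * norm w)\<^sup>2 \<le> d/16" by (simp add: power2_eq_square)
  have "7/16 * d \<le> d - 2 * Re (t * cinner w x) - (cmod t * norm w)\<^sup>2"
    using 1 2 by linarith
  then show ?thesis
    unfolding norm_add_scaleC_square by (simp add: d_def)
qed

section \<open>Bloch functions\<close>

text \<open>
  A pointwise form of the bound on \<open>(1 - \<parallel>x\<parallel>\<^sup>2) \<parallel>\<nabla>f(x)\<parallel>\<close>; keeping the constant explicit makes
  sums and limits of Bloch functions easy to estimate.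
\<close>

definition bloch_bound :: "real \<Rightarrow> ('a::complex_hilbert_space \<Rightarrow> complex) \<Rightarrow> bool" where
  "bloch_bound M f \<longleftrightarrow> holomorphic_on_unit_ball f \<and>
     (\<forall>x\<in>ball 0 1. \<forall>v. (1 - (norm x)\<^sup>2) * cmod (frechet_derivative f (at x) v) \<le> M * norm v)"

definition weighted_radial_derivative :: "('a::complex_hilbert_space \<Rightarrow> complex) \<Rightarrow> 'a \<Rightarrow> complex" where
  "weighted_radial_derivative f x = complex_of_real (1 - (norm x)\<^sup>2) * radial_derivative f x"

lemma one_minus_norm_square_pos: "x \<in> ball 0 1 \<Longrightarrow> 0 < 1 - (norm x)\<^sup>2"
  by (simp add: power_less_one_iff)

lemma holomorphic_frechet_derivative:
  assumes "holomorphic_on_unit_ball f" "x \<in> ball 0 1"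
  shows "(f has_derivative frechet_derivative f (at x)) (at x)"
    and "frechet_derivative f (at x) (c *\<^sub>C v) = c * frechet_derivative f (at x) v"
  using assms frechet_derivative_at unfolding holomorphic_on_unit_ball_def by blast+

lemma bloch_boundI:
  assumes "\<And>x. x \<in> ball 0 1 \<Longrightarrow> (f has_derivative D x) (at x)"
    and "\<And>x c v. x \<in> ball 0 1 \<Longrightarrow> D x (c *\<^sub>C v) = c * D x v"
    and "\<And>x v. x \<in> ball 0 1 \<Longrightarrow> (1 - (norm x)\<^sup>2) * cmod (D x v) \<le> M * norm v"
  shows "bloch_bound M f"
  using assms frechet_derivative_at unfolding bloch_bound_def holomorphic_on_unit_ball_def
  by metis

lemma mem_bloch_space_iff: "f \<in> bloch_space \<longleftrightarrow> (\<exists>M\<ge>0. bloch_bound M f)"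
proof
  assume f: "f \<in> bloch_space"
  then have hol: "holomorphic_on_unit_ball f"
    unfolding bloch_space_def by simp
  obtain M where "\<forall>x\<in>ball 0 1. (1 - (norm x)\<^sup>2) * onorm (frechet_derivative f (at x)) \<le> M"
    using f unfolding bloch_space_def bdd_above_def by blast
  then have M: "(1 - (norm x)\<^sup>2) * onorm (frechet_derivative f (at x)) \<le> M"
    if "x \<in> ball 0 1" for x
    using that by blast
  have "(1 - (norm x)\<^sup>2) * cmod (frechet_derivative f (at x) v) \<le> max M 0 * norm v"
    if x: "x \<in> ball 0 1" for x v
  proof -
    have "cmod (frechet_derivative f (at x) v) \<le> onorm (frechet_derivative f (at x)) * norm v"
      by (rule onorm[OF has_derivative_bounded_linear[OF holomorphic_frechet_derivative(1)[OF hol x]]])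
    then have "(1 - (norm x)\<^sup>2) * cmod (frechet_derivative f (at x) v)
        \<le> (1 - (norm x)\<^sup>2) * (onorm (frechet_derivative f (at x)) * norm v)"
      using one_minus_norm_square_pos[OF x] by (intro mult_left_mono) auto
    also have "\<dots> \<le> max M 0 * norm v"
      unfolding mult.assoc[symmetric] using M[OF x] by (intro mult_right_mono) auto
    finally show ?thesis .
  qed
  then have "bloch_bound (max M 0) f"
    unfolding bloch_bound_def using hol by blast
  then show "\<exists>M\<ge>0. bloch_bound M f" by (meson max.cobounded2)
next
  assume "\<exists>M\<ge>0. bloch_bound M f"
  then obtain M where M: "0 \<le> M" "bloch_bound M f" by blast
  have "(1 - (norm x)\<^sup>2) * onorm (frechet_derivative f (at x)) \<le> M" if x: "x \<in> ball 0 1" for x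
  proof -
    have d: "0 < 1 - (norm x)\<^sup>2" by (rule one_minus_norm_square_pos[OF x])
    have "onorm (frechet_derivative f (at x)) \<le> M / (1 - (norm x)\<^sup>2)"
    proof (rule onorm_bound)
      show "0 \<le> M / (1 - (norm x)\<^sup>2)" using M d by simp
      show "norm (frechet_derivative f (at x) v) \<le> M / (1 - (norm x)\<^sup>2) * norm v" for v
        using M x d unfolding bloch_bound_def by (simp add: field_simps)
    qed
    then show ?thesis using d by (simp add: field_simps)
  qed
  then show "f \<in> bloch_space"
    using M unfolding bloch_space_def bloch_bound_def bdd_above_def by blast
qed

lemma bloch_bound_derivative:
  assumes "bloch_bound M f" "x \<in> ball 0 1"
  shows "cmod (frechet_derivative f (at x) v) \<le> M / (1 - (norm x)\<^sup>2) * norm v"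
  using assms one_minus_norm_square_pos[OF assms(2)] unfolding bloch_bound_def
  by (simp add: field_simps)

lemma bloch_bound_scaleR_diff:
  fixes f g :: "'a::complex_hilbert_space \<Rightarrow> complex" and r :: real
  assumes f: "bloch_bound M f" and g: "bloch_bound N g"
  defines "h \<equiv> \<lambda>x. r *\<^sub>R (f x - g x)"
  shows "bloch_bound (\<bar>r\<bar> * (M + N)) h"
    and "x \<in> ball 0 1 \<Longrightarrow> weighted_radial_derivative h x =
      r *\<^sub>R (weighted_radial_derivative f x - weighted_radial_derivative g x)"
proof -
  let ?D = "\<lambda>x v. r *\<^sub>R (frechet_derivative f (at x) v - frechet_derivative g (at x) v)"
  have hf: "holomorphic_on_unit_ball f" and hg: "holomorphic_on_unit_ball g"
    using f g unfolding bloch_bound_def by auto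
  have D: "(h has_derivative ?D x) (at x)" if "x \<in> ball 0 1" for x
    unfolding h_def
    by (intro has_derivative_scaleR_right has_derivative_diff
        holomorphic_frechet_derivative(1) hf hg that)
  show "bloch_bound (\<bar>r\<bar> * (M + N)) h"
  proof (rule bloch_boundI[OF D])
    fix x :: 'a and c :: complex and v :: 'a
    assume x: "x \<in> ball 0 1"
    show "?D x (c *\<^sub>C v) = c * ?D x v"
      by (simp add: holomorphic_frechet_derivative(2)[OF hf x]
          holomorphic_frechet_derivative(2)[OF hg x] algebra_simps)
    have "(1 - (norm x)\<^sup>2) * cmod (?D x v)
        \<le> \<bar>r\<bar> * ((1 - (norm x)\<^sup>2) * cmod (frechet_derivative f (at x) v)
            + (1 - (norm x)\<^sup>2) * cmod (frechet_derivative g (at x) v))"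
    proof -
      have "cmod (?D x v) \<le> \<bar>r\<bar> *
          (cmod (frechet_derivative f (at x) v) + cmod (frechet_derivative g (at x) v))"
        by (simp add: mult_left_mono norm_triangle_ineq4)
      then have "(1 - (norm x)\<^sup>2) * cmod (?D x v) \<le> (1 - (norm x)\<^sup>2) *
          (\<bar>r\<bar> * (cmod (frechet_derivative f (at x) v) + cmod (frechet_derivative g (at x) v)))"
        using one_minus_norm_square_pos[OF x] by (intro mult_left_mono) auto
      then show ?thesis by (simp add: algebra_simps)
    qed
    also have "\<dots> \<le> \<bar>r\<bar> * (M * norm v + N * norm v)"
      using f g x unfolding bloch_bound_def by (intro mult_left_mono add_mono) auto
    finally show "(1 - (norm x)\<^sup>2) * cmod (?D x v) \<le> \<bar>r\<bar> * (M + N) * norm v"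
      by (simp add: algebra_simps)
  qed
  show "weighted_radial_derivative h x =
      r *\<^sub>R (weighted_radial_derivative f x - weighted_radial_derivative g x)" if "x \<in> ball 0 1"
    unfolding weighted_radial_derivative_def radial_derivative_def
      frechet_derivative_at[OF D[OF that], symmetric] by (simp add: algebra_simps)
qed


section \<open>Perturbing the point of evaluation\<close>

lemma complex_line_has_field_derivative:
  fixes p q :: "'a::complex_hilbert_space"
  assumes f: "holomorphic_on_unit_ball f" and ball: "p + t *\<^sub>C q \<in> ball 0 1"
  shows "((\<lambda>t. f (p + t *\<^sub>C q)) has_field_derivative
           frechet_derivative f (at (p + t *\<^sub>C q)) q) (at t within S)"
proof -
  interpret bounded_linear "\<lambda>t. t *\<^sub>C q" by (rule bounded_linear_scaleC_left)
  have "((\<lambda>t. p + t *\<^sub>C q) has_derivative (\<lambda>h. h *\<^sub>C q)) (at t within S)"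
    by (auto intro!: derivative_eq_intros bounded_linear_imp_has_derivative bounded_linear_axioms)
  from has_derivative_compose[OF this holomorphic_frechet_derivative(1)[OF f ball]]
  have "((\<lambda>t. f (p + t *\<^sub>C q)) has_derivative
      (\<lambda>h. frechet_derivative f (at (p + t *\<^sub>C q)) (h *\<^sub>C q))) (at t within S)" .
  then show ?thesis
    unfolding has_field_derivative_def holomorphic_frechet_derivative(2)[OF f ball]
    by (simp only: mult.commute[of _ "frechet_derivative f (at (p + t *\<^sub>C q)) q"])
qed

text \<open>
  Moving radially by \<open>s z\<close> with \<open>\<bar>s\<bar> \<le> d/16\<close> keeps the point so far inside the ball that
  \<open>\<parallel>\<nabla>f\<parallel> \<le> 4 M/d\<close> along the way; the mean value inequality then bounds the increment independently of
  \<open>d\<close>. The constant \<open>7/16\<close> is the one that holds along the lines of \<open>complex_line_defect\<close>.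
\<close>

lemma bloch_radial_increment:
  fixes z :: "'a::complex_hilbert_space"
  assumes f: "bloch_bound M f" and M: "0 \<le> M"
    and d: "0 < d" "d \<le> 1" "7/16 * d \<le> 1 - (norm z)\<^sup>2" and s: "cmod s \<le> d/16"
  shows "z + s *\<^sub>C z \<in> ball 0 1" and "cmod (f (z + s *\<^sub>C z) - f z) \<le> M/4"
proof -
  have defect: "d/4 \<le> 1 - (norm (z + u *\<^sub>C z))\<^sup>2" if u: "cmod u \<le> d/16" for u
  proof -
    have "z + u *\<^sub>C z = (1 + u) *\<^sub>C z"
      by (simp add: scaleC_add_left scaleC_one)
    then have "(norm (z + u *\<^sub>C z))\<^sup>2 = (cmod (1 + u))\<^sup>2 * (norm z)\<^sup>2"
      by (simp add: norm_scaleC power_mult_distrib)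
    also have "\<dots> \<le> (1 + d/16)\<^sup>2 * (norm z)\<^sup>2"
      using norm_triangle_ineq[of 1 u] u by (intro mult_right_mono power_mono) auto
    also have "\<dots> \<le> (1 + d/16)\<^sup>2 * (1 - 7/16 * d)"
      using d by (intro mult_left_mono) auto
    also have "\<dots> \<le> 1 - d/4"
      using d by (simp add: power2_eq_square algebra_simps)
    finally show ?thesis by simp
  qed
  have ball: "z + u *\<^sub>C z \<in> ball 0 1" if "cmod u \<le> d/16" for u
    using defect[OF that] d(1) abs_square_less_1[of "norm (z + u *\<^sub>C z)"] by simp
  show "z + s *\<^sub>C z \<in> ball 0 1" by (rule ball[OF s])
  have z1: "norm z \<le> 1"
    using d(1,3) abs_square_le_1[of "norm z"] by simp
  have "cmod (f (z + s *\<^sub>C z) - f (z + 0 *\<^sub>C z)) \<le> 4 * M / d * cmod (s - 0)"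
  proof (rule field_differentiable_bound[where S = "cball 0 (d/16)"])
    fix u :: complex assume "u \<in> cball 0 (d/16)"
    then have u: "cmod u \<le> d/16" by simp
    show "((\<lambda>u. f (z + u *\<^sub>C z)) has_field_derivative
        frechet_derivative f (at (z + u *\<^sub>C z)) z) (at u within cball 0 (d/16))"
      using f ball[OF u] unfolding bloch_bound_def by (intro complex_line_has_field_derivative) auto
    have "cmod (frechet_derivative f (at (z + u *\<^sub>C z)) z)
        \<le> M / (1 - (norm (z + u *\<^sub>C z))\<^sup>2) * norm z"
      by (rule bloch_bound_derivative[OF f ball[OF u]])
    also have "\<dots> \<le> M / (d/4) * 1"
      using defect[OF u] d M z1 by (intro mult_mono divide_left_mono) auto
    finally show "cmod (frechet_derivative f (at (z + u *\<^sub>C z)) z) \<le> 4 * M / d"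
      by (simp add: mult.commute)
  qed (use s d in auto)
  also have "\<dots> \<le> 4 * M / d * (d/16)"
    using s M d by (intro mult_left_mono) auto
  finally show "cmod (f (z + s *\<^sub>C z) - f z) \<le> M/4"
    using d scaleC_add_left[of 0 0 z] by simp
qed

text \<open>
  Cauchy's estimate is applied twice: along the line through \<open>x\<close> and \<open>y\<close>, which gains the factor
  \<open>\<delta>\<close>, and in the radial variable, which turns increments into radial derivatives at the cost of a
  factor \<open>1/d\<close>. This gives \<open>64 \<delta> M\<close>. The change of the weight from \<open>1 - \<parallel>x\<parallel>\<^sup>2\<close> to
  \<open>1 - \<parallel>y\<parallel>\<^sup>2\<close> contributes the remaining \<open>20 \<delta> M\<close>.
\<close>

lemma weighted_radial_derivative_perturbation:
  fixes x y :: "'a::complex_hilbert_space"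
  assumes f: "bloch_bound M f" and M: "0 \<le> M"
    and x: "x \<in> ball 0 1" and y: "y \<in> ball 0 1"
    and \<delta>: "0 < \<delta>" "\<delta> \<le> 1/16" and close: "pseudohyperbolic_dist x y < \<delta>"
  shows "cmod (weighted_radial_derivative f x - weighted_radial_derivative f y) \<le> 84 * \<delta> * M"
proof -
  define d where "d = 1 - (norm x)\<^sup>2"
  define e where "e = 1 - (norm y)\<^sup>2"
  define w where "w = y - x"
  define R where "R = 1 / (8 * \<delta>)"
  have hol: "holomorphic_on_unit_ball f" using f unfolding bloch_bound_def by simp
  have d: "0 < d" "d \<le> 1"
    unfolding d_def using one_minus_norm_square_pos[OF x] by simp_all
  have R: "2 \<le> R" unfolding R_def using \<delta> by (simp add: field_simps)
  have w: "cmod (cinner w x) \<le> 2 * \<delta> * d" "(norm w)\<^sup>2 \<le> 4 * \<delta>\<^sup>2 * d"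
    using pseudohyperbolic_dist_displacement[OF _ \<delta>(1) _ close] x \<delta>(2)
    unfolding d_def w_def by auto
  have defect: "7/16 * d \<le> 1 - (norm (x + t *\<^sub>C w))\<^sup>2" if "cmod t \<le> R" for t
    unfolding d_def by (rule complex_line_defect) (use d w \<delta> that in \<open>auto simp: d_def R_def\<close>)
  have x0: "x + 0 *\<^sub>C w = x" using scaleC_add_left[of 0 0 w] by simp
  have y1: "x + 1 *\<^sub>C w = y" by (simp add: w_def scaleC_one)
  \<comment> \<open>The complex line through \<open>x = z 0\<close> and \<open>y = z 1\<close>, and the radial increments of \<open>f\<close> along it.\<close>
  define z where "z = (\<lambda>t. x + t *\<^sub>C w)"
  have z_ball: "z t \<in> ball 0 1" if "cmod t \<le> R" for t
    using defect[OF that] d(1) abs_square_less_1[of "norm (x + t *\<^sub>C w)"] by (simp add: z_def)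
  define G where "G = (\<lambda>s t. f (z t + s *\<^sub>C z t) - f (z t))"
  define D where "D = (\<lambda>s t. frechet_derivative f (at (z t + s *\<^sub>C z t)) (w + s *\<^sub>C w)
      - frechet_derivative f (at (z t)) w)"
  have G_bound: "cmod (G s t) \<le> M/4" if "cmod s \<le> d/16" "cmod t \<le> R" for s t
    unfolding G_def
    by (rule bloch_radial_increment(2)[OF f M d]) (use that defect in \<open>auto simp: z_def\<close>)
  have G_deriv: "(G s has_field_derivative D s t) (at t within S)"
    if s: "cmod s \<le> d/16" and t: "cmod t \<le> R" for s t S
  proof -
    have eq: "z t + s *\<^sub>C z t = (x + s *\<^sub>C x) + t *\<^sub>C (w + s *\<^sub>C w)" for t
      by (simp add: z_def scaleC_add_right scaleC_scaleC mult.commute)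
    have "z t + s *\<^sub>C z t \<in> ball 0 1"
      by (rule bloch_radial_increment(1)[OF f M d]) (use that defect in \<open>auto simp: z_def\<close>)
    then show ?thesis
      using z_ball[OF t] unfolding G_def D_def eq unfolding z_def
      by (intro DERIV_diff complex_line_has_field_derivative hol)
  qed
  \<comment> \<open>Cauchy's estimate in the variable along the line: a disc of radius \<open>R/2\<close> about a point with
    \<open>\<bar>t\<bar> \<le> 1\<close> stays within \<open>\<bar>u\<bar> \<le> R\<close> because \<open>R \<ge> 2\<close>.\<close>
  have D_bound: "cmod (D s t) \<le> 4 * \<delta> * M" if s: "cmod s \<le> d/16" and t: "cmod t \<le> 1" for s t
  proof -
    have sub: "cmod u \<le> R" if "u \<in> cball t (R/2)" for u
      using that t R norm_triangle_ineq2[of u t] by (auto simp: dist_norm norm_minus_commute)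
    have hol_G: "G s holomorphic_on cball t (R/2)"
      unfolding holomorphic_on_def field_differentiable_def using G_deriv[OF s sub] by blast
    have "norm ((deriv ^^ 1) (G s) t) \<le> fact 1 * (M/4) / (R/2) ^ 1"
    proof (rule Cauchy_inequality)
      show "norm (G s u) \<le> M/4" if "norm (t - u) = R/2" for u
        by (intro G_bound s sub) (use that in \<open>simp add: dist_norm\<close>)
      show "G s holomorphic_on ball t (R/2)"
        by (rule holomorphic_on_subset[OF hol_G]) auto
    qed (use R hol_G in \<open>auto intro: holomorphic_on_imp_continuous_on\<close>)
    moreover have "deriv (G s) t = D s t"
      by (rule DERIV_imp_deriv[OF G_deriv[OF s]]) (use t R in linarith)
    ultimately show ?thesis
      using \<delta>(1) by (simp add: R_def field_simps)
  qed
  define H where "H = (\<lambda>s. f (y + s *\<^sub>C y) - f (x + s *\<^sub>C x) - (f y - f x))"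
  have H_bound: "cmod (H s) \<le> 4 * \<delta> * M" if s: "cmod s \<le> d/16" for s
  proof -
    have "cmod (G s 1 - G s 0) \<le> 4 * \<delta> * M * cmod (1 - 0)"
      by (rule field_differentiable_bound[where S = "cball 0 1" and f' = "D s"])
        (use G_deriv[OF s] D_bound[OF s] R in auto)
    moreover have "z 0 = x" "z 1 = y" unfolding z_def by (fact x0, fact y1)
    ultimately show ?thesis
      by (simp add: G_def H_def algebra_simps)
  qed
  have xy_ball: "x + s *\<^sub>C x \<in> ball 0 1" "y + s *\<^sub>C y \<in> ball 0 1" if s: "cmod s \<le> d/16" for s
    using bloch_radial_increment(1)[OF f M d _ s, of x] bloch_radial_increment(1)[OF f M d _ s, of y]
      defect[of 0] defect[of 1] R by (auto simp: x0 y1)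
  have H_deriv: "(H has_field_derivative (frechet_derivative f (at (y + s *\<^sub>C y)) y
      - frechet_derivative f (at (x + s *\<^sub>C x)) x)) (at s within S)" if s: "cmod s \<le> d/16" for s S
  proof -
    have "(H has_field_derivative (frechet_derivative f (at (y + s *\<^sub>C y)) y
      - frechet_derivative f (at (x + s *\<^sub>C x)) x - 0)) (at s within S)"
      unfolding H_def
      by (intro DERIV_diff DERIV_const complex_line_has_field_derivative hol xy_ball s)
    then show ?thesis by simp
  qed
  \<comment> \<open>Cauchy's estimate in the radial variable, where \<open>H s = G s 1 - G s 0\<close>.\<close>
  have hol_H: "H holomorphic_on cball 0 (d/16)"
    unfolding holomorphic_on_def field_differentiable_def
    by (intro ballI exI, rule H_deriv) simp
  have "norm ((deriv ^^ 1) H 0) \<le> fact 1 * (4 * \<delta> * M) / (d/16) ^ 1"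
  proof (rule Cauchy_inequality)
    show "H holomorphic_on ball 0 (d/16)"
      by (rule holomorphic_on_subset[OF hol_H]) auto
  qed (use d hol_H H_bound in \<open>auto intro: holomorphic_on_imp_continuous_on\<close>)
  moreover have "deriv H 0 = radial_derivative f y - radial_derivative f x"
    using DERIV_imp_deriv[OF H_deriv[of 0]] d scaleC_add_left[of 0 0 x] scaleC_add_left[of 0 0 y]
    by (simp add: radial_derivative_def)
  ultimately have rad: "cmod (radial_derivative f y - radial_derivative f x) \<le> 64 * \<delta> * M / d"
    by simp
  have e: "7/16 * d \<le> e" using defect[of 1] R by (simp add: y1 e_def)
  have "e = d - 2 * Re (cinner w x) - (norm w)\<^sup>2"
    unfolding e_def d_def y1[symmetric] norm_add_scaleC_square by simp
  moreover have "\<bar>Re (cinner w x)\<bar> \<le> 2 * \<delta> * d"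
    using abs_Re_le_cmod w(1) by (rule order_trans)
  moreover have "4 * \<delta>\<^sup>2 * d \<le> \<delta> * d"
    using \<delta> d by (simp add: power2_eq_square)
  ultimately have de: "\<bar>d - e\<bar> \<le> 5 * \<delta> * d"
    using w(2) zero_le_power2[of "norm w"] by linarith
  have "cmod (radial_derivative f y) \<le> M / e * norm y"
    unfolding radial_derivative_def e_def by (rule bloch_bound_derivative[OF f y])
  also have "\<dots> \<le> M / (d/4) * 1"
    using M d e y by (intro mult_mono divide_left_mono) auto
  finally have rad_y: "cmod (radial_derivative f y) \<le> 4 * M / d" by (simp add: mult.commute)
  have "weighted_radial_derivative f x - weighted_radial_derivative f y
      = (d - e) *\<^sub>R radial_derivative f y
        - d *\<^sub>R (radial_derivative f y - radial_derivative f x)"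
    unfolding weighted_radial_derivative_def d_def[symmetric] e_def[symmetric]
    by (simp add: scaleR_conv_of_real algebra_simps)
  then have "cmod (weighted_radial_derivative f x - weighted_radial_derivative f y)
      \<le> \<bar>d - e\<bar> * cmod (radial_derivative f y)
        + d * cmod (radial_derivative f y - radial_derivative f x)"
    using d(1) norm_triangle_ineq4[of "(d - e) *\<^sub>R radial_derivative f y"
        "d *\<^sub>R (radial_derivative f y - radial_derivative f x)"] by simp
  also have "\<dots> \<le> (5 * \<delta> * d) * (4 * M / d) + d * (64 * \<delta> * M / d)"
    using de rad rad_y d M \<delta> by (intro add_mono mult_mono) auto
  also have "\<dots> = 84 * \<delta> * M" using d by simp
  finally show ?thesis .
qed


section \<open>Series of Bloch functions\<close>

text \<open>
  The derivatives form a series dominated by a geometric one, uniformly on every smaller ball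
  \<open>\<parallel>x\<parallel> < r < 1\<close>, so the series of functions may be differentiated term by term there.
\<close>

lemma bloch_bound_geometric_series:
  fixes f :: "nat \<Rightarrow> 'a::complex_hilbert_space \<Rightarrow> complex"
  assumes f: "\<And>k. bloch_bound (M / 2 ^ k) (f k)" and M: "0 \<le> M"
  obtains g where "bloch_bound (2 * M) g"
    and "\<And>x. x \<in> ball 0 1 \<Longrightarrow>
      (\<lambda>k. weighted_radial_derivative (f k) x) sums weighted_radial_derivative g x"
proof -
  have hol: "holomorphic_on_unit_ball (f k)" for k
    using f unfolding bloch_bound_def by blast
  define D where "D = (\<lambda>k x. frechet_derivative (f k) (at x))"
  define D' where "D' = (\<lambda>x v. \<Sum>k. D k x v)"
  \<comment> \<open>The values at the origin are removed, since a Bloch bound does not control them.\<close>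
  define g where "g = (\<lambda>x. \<Sum>k. f k x - f k 0)"
  define b where "b = (\<lambda>x (v::'a). M * norm v / (1 - (norm (x::'a))\<^sup>2))"
  have D_le: "norm (D k x v) \<le> b x v * (1/2) ^ k" if "x \<in> ball 0 1" for k x v
    using bloch_bound_derivative[OF f that, of k v]
    by (simp add: D_def b_def field_simps power_one_over)
  have geo: "(\<lambda>k. c * (1/2) ^ k) sums (2 * c)" for c :: real
    using sums_mult[OF geometric_sums[of "1/2 :: real"], of c] by (simp add: mult.commute)
  have geo': "summable (\<lambda>k. c * (1/2) ^ k)" for c :: real
    using geo by (rule sums_summable)
  have D_summable: "summable (\<lambda>k. D k x v)" if "x \<in> ball 0 1" for x v
    by (rule summable_comparison_test'[OF geo', where N = 0]) (use D_le[OF that] in blast)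
  have tail: "norm ((\<Sum>k<n. D k x v) - D' x v) \<le> 2 * b x v * (1/2) ^ n"
    if x: "x \<in> ball 0 1" for n x v
  proof -
    have "norm (\<Sum>k. D (k + n) x v) \<le> 2 * (b x v * (1/2) ^ n)"
    proof (rule norm_sums_le[OF _ geo])
      show "(\<lambda>k. D (k + n) x v) sums (\<Sum>k. D (k + n) x v)"
        by (rule summable_sums, rule summable_ignore_initial_segment[where f = "\<lambda>k. D k x v"])
          (rule D_summable[OF x])
      show "norm (D (k + n) x v) \<le> b x v * (1/2) ^ n * (1/2) ^ k" for k
        using D_le[OF x, of "k + n" v] by (simp add: power_add mult.commute mult.left_commute)
    qed
    moreover have "(\<Sum>k<n. D k x v) - D' x v = - (\<Sum>k. D (k + n) x v)"
      unfolding D'_def using suminf_minus_initial_segment[OF D_summable[OF x]] by simp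
    ultimately show ?thesis by simp
  qed
  have g_deriv: "(g has_derivative D' x) (at x)" if x: "x \<in> ball 0 1" for x
  proof -
    define r where "r = (1 + norm x) / 2"
    have r: "0 < r" "r < 1" "norm x < r"
      unfolding r_def using x by (auto intro: add_pos_nonneg)
    define c where "c = 2 * M / (1 - r\<^sup>2)"
    have r2: "0 < 1 - r\<^sup>2" using r by (simp add: power_less_one_iff)
    have sub: "ball 0 r \<subseteq> ball (0::'a) 1" using r by auto
    have "\<exists>h. \<forall>z\<in>ball 0 r. (\<lambda>k. f k z - f k 0) sums h z \<and>
        (h has_derivative D' z) (at z within ball 0 r)"
    proof (rule has_derivative_series)
      show "((\<lambda>z. f k z - f k 0) has_derivative D k z) (at z within ball 0 r)"
        if "z \<in> ball 0 r" for k z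
      proof -
        have "(f k has_derivative D k z) (at z)"
          unfolding D_def by (rule holomorphic_frechet_derivative(1)[OF hol]) (use sub that in blast)
        then have "((\<lambda>z. f k z - f k 0) has_derivative (\<lambda>v. D k z v - 0)) (at z within ball 0 r)"
          by (rule has_derivative_diff[OF has_derivative_at_withinI has_derivative_const])
        then show ?thesis by simp
      qed
      show "\<forall>\<^sub>F n in sequentially. \<forall>z\<in>ball 0 r. \<forall>v. norm ((\<Sum>k<n. D k z v) - D' z v) \<le> e * norm v"
        if e: "0 < e" for e
      proof -
        have "(\<lambda>n. c * (1/2) ^ n) \<longlonglongrightarrow> 0"
          using geo' by (rule summable_LIMSEQ_zero)
        then have "\<forall>\<^sub>F n in sequentially. c * (1/2) ^ n < e"
          using e by (rule order_tendstoD(2))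
        then show ?thesis
        proof (eventually_elim, intro ballI allI)
          fix n z and v :: 'a
          assume n: "c * (1/2) ^ n < e" and z: "z \<in> ball (0::'a) r"
          have z2: "(norm z)\<^sup>2 \<le> r\<^sup>2" using z by (intro power_mono) auto
          have "2 * b z v * (1/2) ^ n \<le> (c * norm v) * (1/2) ^ n"
          proof (rule mult_right_mono)
            have "2 * b z v = 2 * M * norm v / (1 - (norm z)\<^sup>2)"
              by (simp add: b_def)
            also have "\<dots> \<le> 2 * M * norm v / (1 - r\<^sup>2)"
              using z2 r2 M by (intro divide_left_mono mult_nonneg_nonneg mult_pos_pos) auto
            finally show "2 * b z v \<le> c * norm v" by (simp add: c_def)
          qed simp
          also have "\<dots> = c * (1/2) ^ n * norm v" by simp
          also have "\<dots> \<le> e * norm v"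
            using n by (intro mult_right_mono) auto
          finally show "norm ((\<Sum>k<n. D k z v) - D' z v) \<le> e * norm v"
            using tail[where x = z and n = n and v = v] sub z by (meson order_trans subsetD)
        qed
      qed
      show "(\<lambda>k. f k 0 - f k 0) sums 0" by simp
    qed (use r in auto)
    then obtain h where h: "\<And>z. z \<in> ball 0 r \<Longrightarrow> (\<lambda>k. f k z - f k 0) sums h z"
      "\<And>z. z \<in> ball 0 r \<Longrightarrow> (h has_derivative D' z) (at z within ball 0 r)"
      by blast
    have xr: "x \<in> ball 0 r" using r by simp
    then have "(h has_derivative D' x) (at x)"
      using h(2)[OF xr] by (simp add: at_within_open[OF xr])
    then show ?thesis
      by (rule has_derivative_transform_within_open[OF _ open_ball xr])
        (simp add: g_def sums_unique[OF h(1)])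
  qed
  have "bloch_bound (2 * M) g"
  proof (rule bloch_boundI[OF g_deriv])
    fix x v :: 'a and c :: complex
    assume x: "x \<in> ball 0 1"
    show "D' x (c *\<^sub>C v) = c * D' x v"
      unfolding D'_def suminf_mult[OF D_summable[OF x], symmetric]
      by (simp add: D_def holomorphic_frechet_derivative(2)[OF hol x])
    show "(1 - (norm x)\<^sup>2) * cmod (D' x v) \<le> 2 * M * norm v"
      using tail[OF x, where n = 0 and v = v] one_minus_norm_square_pos[OF x] by (simp add: b_def field_simps)
  qed
  moreover have "(\<lambda>k. weighted_radial_derivative (f k) x) sums weighted_radial_derivative g x"
    if x: "x \<in> ball 0 1" for x
    unfolding weighted_radial_derivative_def radial_derivative_def
      frechet_derivative_at[OF g_deriv[OF x], symmetric]
    unfolding D'_def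
    using sums_mult[OF summable_sums[OF D_summable[OF x]]] by (simp add: D_def)
  ultimately show ?thesis by (rule that)
qed

section \<open>Bounded interpolation\<close>

lemma bloch_bound_mono: "bloch_bound M f \<Longrightarrow> M \<le> N \<Longrightarrow> bloch_bound N f"
  unfolding bloch_bound_def by (meson mult_right_mono norm_ge_zero order_trans)

lemma bloch_interpolating_iff:
  "bloch_interpolating x \<longleftrightarrow> range x \<subseteq> ball 0 1 - {0} \<and>
     (\<forall>a. bounded (range a) \<longrightarrow>
        (\<exists>M\<ge>0. \<exists>f. bloch_bound M f \<and> (\<forall>n. weighted_radial_derivative f (x n) = a n)))"
  unfolding bloch_interpolating_def weighted_radial_derivative_def Bex_def mem_bloch_space_iff
  by blast

text \<open>
  A uniform limit of bounded continuous functions is again one, on every topological space. The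
  case of interest is the discrete space \<open>\<nat>\<close>, where these functions are the bounded sequences.
\<close>

lemma completely_metrizable_space_bcontfun:
  "completely_metrizable_space
     (euclidean :: ('b::topological_space \<Rightarrow>\<^sub>C 'c::complete_space) topology)"
proof -
  have "complete (UNIV :: ('b \<Rightarrow>\<^sub>C 'c) set)"
  proof (rule completeI)
    fix f :: "nat \<Rightarrow> 'b \<Rightarrow>\<^sub>C 'c"
    assume f: "Cauchy f"
    have "\<exists>N. \<forall>m n x. N \<le> m \<and> N \<le> n \<and> True \<longrightarrow> dist (f m x) (f n x) < e" if "0 < e" for e
    proof -
      obtain N where "\<forall>m\<ge>N. \<forall>n\<ge>N. dist (f m) (f n) < e"
        using f \<open>0 < e\<close> unfolding Cauchy_def by blast
      then show ?thesis using dist_fun_lt_imp_dist_val_lt by blast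
    qed
    then obtain g where "\<forall>e>0. \<exists>N. \<forall>n x. N \<le> n \<and> True \<longrightarrow> dist (f n x) (g x) < e"
      using uniformly_convergent_eq_cauchy[of "\<lambda>_. True" "\<lambda>n. apply_bcontfun (f n)"] by blast
    then have "uniform_limit UNIV (\<lambda>n. apply_bcontfun (f n)) g sequentially"
      unfolding uniform_limit_sequentially_iff by simp
    then show "\<exists>l\<in>UNIV. f \<longlonglongrightarrow> l"
      by (rule uniform_limit_bcontfunE) auto
  qed
  then show ?thesis
    using Met_TC.completely_metrizable_space_mtopology by auto
qed

text \<open>
  Let \<open>A k\<close> be the set of sequences interpolated by a function with Bloch bound \<open>k\<close>. These sets cover
  the complete space of bounded sequences, so by Baire's theorem the closure of some \<open>A k\<close> contains
  a ball, with centre \<open>a0\<close> and radius \<open>\<epsilon>\<close> say. For \<open>a\<close> in the unit ball, \<open>a0\<close> and \<open>a0 + (\<epsilon>/2) a\<close> are approximated by elements of \<open>A k\<close>; the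
  difference of the two interpolating functions, multiplied by \<open>2/\<epsilon>\<close>, approximates \<open>a\<close>. As in
  the proof of the open mapping theorem, approximate solutions with a uniform bound are enough, and
  they can be passed on to a nearby sequence of points.
\<close>

lemma bloch_interpolating_approximation:
  fixes x :: "nat \<Rightarrow> 'a::complex_hilbert_space"
  assumes x: "bloch_interpolating x"
  obtains K where "0 \<le> K"
    and "\<And>a. (\<And>n. cmod (a n) \<le> 1) \<Longrightarrow>
      \<exists>f. bloch_bound K f \<and> (\<forall>n. cmod (a n - weighted_radial_derivative f (x n)) \<le> 1/4)"
proof -
  have ball: "x n \<in> ball 0 1" for n
    using x unfolding bloch_interpolating_def by blast
  define A :: "nat \<Rightarrow> (nat \<Rightarrow>\<^sub>C complex) set" where
    "A k = {a. \<exists>f. bloch_bound (real k) f \<and>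
      (\<forall>n. weighted_radial_derivative f (x n) = apply_bcontfun a n)}"
    for k
  have "\<exists>k. a \<in> A k" for a
  proof -
    have "bounded (range (apply_bcontfun a))" by simp
    then obtain M f where "bloch_bound M f" "\<forall>n. weighted_radial_derivative f (x n) = a n"
      using x unfolding bloch_interpolating_iff by blast
    moreover obtain k where "M \<le> real k" using real_arch_simple by blast
    ultimately show ?thesis
      unfolding A_def using bloch_bound_mono by blast
  qed
  then have "\<exists>k. a \<in> closure (A k)" for a
    using closure_subset subsetD by metis
  then have "\<Union>(range (\<lambda>k. closure (A k))) = UNIV"
    by auto
  moreover have "euclidean interior_of \<Union>(range (\<lambda>k. closure (A k))) = {}"
    if empty: "\<And>k. interior (closure (A k)) = {}"
  proof (rule Baire_category_alt)
    show "closedin euclidean T \<and> euclidean interior_of T = {}"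
      if T: "T \<in> range (\<lambda>k. closure (A k))" for T
    proof -
      obtain k where "T = closure (A k)" using T by blast
      then show ?thesis using empty[of k] by simp
    qed
  qed (intro disjI1 completely_metrizable_space_bcontfun, simp)
  ultimately have "\<exists>k. interior (closure (A k)) \<noteq> {}"
    by (metis UNIV_not_empty euclidean_interior_of interior_UNIV)
  then obtain k a0 where "a0 \<in> interior (closure (A k))" by blast
  then obtain \<epsilon> where \<epsilon>: "0 < \<epsilon>" and sub: "ball a0 \<epsilon> \<subseteq> closure (A k)"
    unfolding mem_interior by blast
  show ?thesis
  proof (rule that)
    show "0 \<le> \<bar>2 / \<epsilon>\<bar> * (real k + real k)" by simp
    fix a :: "nat \<Rightarrow> complex" assume a: "\<And>n. cmod (a n) \<le> 1"
    have "bounded (range (\<lambda>n. a0 n + (\<epsilon>/2) *\<^sub>R a n))"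
    proof -
      have "bounded (range a)" using a unfolding bounded_iff by blast
      then show ?thesis
        by (intro bounded_plus_comp bounded_scaleR_comp bounded_apply_bcontfun)
    qed
    then have "(\<lambda>n. a0 n + (\<epsilon>/2) *\<^sub>R a n) \<in> bcontfun"
      by (simp add: bcontfun_def)
    then obtain b where "(\<lambda>n. a0 n + (\<epsilon>/2) *\<^sub>R a n) = apply_bcontfun b"
      by (rule bcontfunE)
    then have b: "b n = a0 n + (\<epsilon>/2) *\<^sub>R a n" for n by metis
    have "dist a0 b \<le> \<epsilon>/2"
    proof (rule dist_bound)
      show "dist (a0 n) (b n) \<le> \<epsilon>/2" for n
        using a[of n] \<epsilon> by (simp add: b dist_norm)
    qed
    then have "b \<in> closure (A k)" "a0 \<in> closure (A k)"
      using sub \<epsilon> by auto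
    then obtain b' a0' where near: "b' \<in> A k" "dist b' b < \<epsilon>/16" "a0' \<in> A k" "dist a0' a0 < \<epsilon>/16"
      using \<epsilon> unfolding closure_approachable by (meson divide_pos_pos zero_less_numeral)
    then obtain f f0 where f: "bloch_bound (real k) f" "\<And>n. weighted_radial_derivative f (x n) = b' n"
      and f0: "bloch_bound (real k) f0" "\<And>n. weighted_radial_derivative f0 (x n) = a0' n"
      unfolding A_def by blast
    define h where "h = (\<lambda>z. (2 / \<epsilon>) *\<^sub>R (f z - f0 z))"
    have "cmod (a n - weighted_radial_derivative h (x n)) \<le> 1/4" for n
    proof -
      have "a n - weighted_radial_derivative h (x n)
          = (2 / \<epsilon>) *\<^sub>R ((a0' n - a0 n) - (b' n - b n))"
        unfolding h_def bloch_bound_scaleR_diff(2)[OF f(1) f0(1) ball] f(2) f0(2) b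
        using \<epsilon> by (simp add: algebra_simps)
      then have "cmod (a n - weighted_radial_derivative h (x n))
          = (2 / \<epsilon>) * cmod ((a0' n - a0 n) - (b' n - b n))"
        using \<epsilon> by simp
      also have "\<dots> \<le> (2 / \<epsilon>) * (cmod (a0' n - a0 n) + cmod (b' n - b n))"
        using \<epsilon> by (intro mult_left_mono norm_triangle_ineq4) auto
      also have "\<dots> \<le> (2 / \<epsilon>) * (\<epsilon>/16 + \<epsilon>/16)"
        using \<epsilon> dist_fun_lt_imp_dist_val_lt[OF near(2), of n]
          dist_fun_lt_imp_dist_val_lt[OF near(4), of n]
        by (intro mult_left_mono add_mono) (auto simp: dist_norm)
      finally show ?thesis using \<epsilon> by simp
    qed
    moreover have "bloch_bound (\<bar>2 / \<epsilon>\<bar> * (real k + real k)) h"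
      unfolding h_def by (rule bloch_bound_scaleR_diff(1)[OF f(1) f0(1)])
    ultimately show "\<exists>f. bloch_bound (\<bar>2 / \<epsilon>\<bar> * (real k + real k)) f \<and>
        (\<forall>n. cmod (a n - weighted_radial_derivative f (x n)) \<le> 1/4)"
      by blast
  qed
qed

text \<open>
  Solving approximately for \<open>a\<close>, then for the remaining error, and so on, halves the error in each
  step; the corrections have Bloch bounds that decrease like \<open>1/2 ^ k\<close>, so their sum exists and
  interpolates exactly.
\<close>

lemma interpolation_by_successive_approximation:
  fixes y :: "nat \<Rightarrow> 'a::complex_hilbert_space"
  assumes y: "\<And>n. y n \<in> ball 0 1" and K: "0 \<le> K"
    and approx: "\<And>a. (\<And>n. cmod (a n) \<le> 1) \<Longrightarrow>
      \<exists>f. bloch_bound K f \<and> (\<forall>n. cmod (a n - weighted_radial_derivative f (y n)) \<le> 1/2)"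
    and a: "bounded (range a)"
  shows "\<exists>M\<ge>0. \<exists>f. bloch_bound M f \<and> (\<forall>n. weighted_radial_derivative f (y n) = a n)"
proof -
  have zero: "bloch_bound 0 (\<lambda>x::'a. 0)"
    by (rule bloch_boundI[where D = "\<lambda>x v. 0"]) auto
  have zero': "weighted_radial_derivative (\<lambda>x::'a. 0) z = 0" for z
    by (simp add: weighted_radial_derivative_def radial_derivative_def)
  have scaled: "\<exists>f. bloch_bound (c * K) f \<and>
      (\<forall>n. cmod (r n - weighted_radial_derivative f (y n)) \<le> c/2)"
    if c: "0 < c" and r: "\<And>n. cmod (r n) \<le> c" for c r
  proof -
    obtain f where f: "bloch_bound K f"
      "\<And>n. cmod ((1/c) *\<^sub>R r n - weighted_radial_derivative f (y n)) \<le> 1/2"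
      using approx[of "\<lambda>n. (1/c) *\<^sub>R r n"] c r by (auto simp: field_simps)
    define h where "h = (\<lambda>z. c *\<^sub>R (f z - 0))"
    have "bloch_bound (\<bar>c\<bar> * (K + 0)) h"
      unfolding h_def by (rule bloch_bound_scaleR_diff(1)[OF f(1) zero])
    moreover have "cmod (r n - weighted_radial_derivative h (y n)) \<le> c/2" for n
    proof -
      have "r n - weighted_radial_derivative h (y n)
          = c *\<^sub>R ((1/c) *\<^sub>R r n - weighted_radial_derivative f (y n))"
        unfolding h_def bloch_bound_scaleR_diff(2)[OF f(1) zero y] zero'
        using c by (simp add: algebra_simps)
      then show ?thesis using mult_left_mono[OF f(2)[of n], of c] c by simp
    qed
    ultimately show ?thesis using c by auto
  qed
  obtain C where C: "0 < C" "\<And>n. cmod (a n) \<le> C"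
    using a unfolding bounded_pos by blast
  \<comment> \<open>The \<open>k\<close>-th residual \<open>r k\<close> is what the first \<open>k\<close> corrections leave of \<open>a\<close>.\<close>
  have "\<exists>r. \<forall>k. ((k = 0 \<longrightarrow> r k = a) \<and> (\<forall>n. cmod (r k n) \<le> C / 2 ^ k)) \<and>
      (\<exists>f. bloch_bound (C * K / 2 ^ k) f \<and>
        r (Suc k) = (\<lambda>n. r k n - weighted_radial_derivative f (y n)))"
  proof (rule dependent_nat_choice)
    show "\<exists>r. (0 = (0::nat) \<longrightarrow> r = a) \<and> (\<forall>n. cmod (r n) \<le> C / 2 ^ 0)"
      using C(2) by auto
    fix r k assume "(k = 0 \<longrightarrow> r = a) \<and> (\<forall>n. cmod (r n) \<le> C / 2 ^ k)"
    then obtain f where "bloch_bound (C / 2 ^ k * K) f"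
      "\<And>n. cmod (r n - weighted_radial_derivative f (y n)) \<le> C / 2 ^ k / 2"
      using scaled[of "C / 2 ^ k" r] C(1) by auto
    then show "\<exists>r'. ((Suc k = 0 \<longrightarrow> r' = a) \<and> (\<forall>n. cmod (r' n) \<le> C / 2 ^ Suc k)) \<and>
        (\<exists>f. bloch_bound (C * K / 2 ^ k) f \<and>
          r' = (\<lambda>n. r n - weighted_radial_derivative f (y n)))"
      by (intro exI[of _ "\<lambda>n. r n - weighted_radial_derivative f (y n)"] conjI exI[of _ f])
        (auto simp: mult.commute)
  qed
  then obtain r where r0: "r 0 = a" and r: "\<And>k n. cmod (r k n) \<le> C / 2 ^ k"
    and "\<forall>k. \<exists>f. bloch_bound (C * K / 2 ^ k) f \<and>
        r (Suc k) = (\<lambda>n. r k n - weighted_radial_derivative f (y n))"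
    by metis
  then obtain f where f: "\<And>k. bloch_bound (C * K / 2 ^ k) (f k)"
    and r_Suc: "\<And>k. r (Suc k) = (\<lambda>n. r k n - weighted_radial_derivative (f k) (y n))"
    by metis
  obtain g where g: "bloch_bound (2 * (C * K)) g"
    "\<And>z. z \<in> ball 0 1 \<Longrightarrow>
      (\<lambda>k. weighted_radial_derivative (f k) z) sums weighted_radial_derivative g z"
    using bloch_bound_geometric_series[OF f] C(1) K by (metis less_imp_le mult_nonneg_nonneg)
  have "weighted_radial_derivative g (y n) = a n" for n
  proof -
    have "(\<lambda>k. r k n) \<longlonglongrightarrow> 0"
    proof (rule Lim_null_comparison)
      show "\<forall>\<^sub>F k in sequentially. norm (r k n) \<le> C * (1/2) ^ k"
        using r by (simp add: power_one_over divide_simps)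
      show "(\<lambda>k. C * (1/2) ^ k) \<longlonglongrightarrow> 0"
        by (intro tendsto_mult_right_zero LIMSEQ_power_zero) simp
    qed
    then have "(\<lambda>k. r k n - r (Suc k) n) sums (r 0 n - 0)"
      by (rule telescope_sums')
    then have "(\<lambda>k. weighted_radial_derivative (f k) (y n)) sums a n"
      by (simp add: r_Suc r0)
    then show ?thesis
      using g(2)[OF y] sums_unique2 by blast
  qed
  then show ?thesis
    using g(1) C(1) K by (intro exI[of _ "2 * (C * K)"]) auto
qed

theorem theorem3p7:
  fixes x :: "nat \<Rightarrow> 'a::complex_hilbert_space"
  assumes "bloch_interpolating x"
  shows "\<exists>\<delta>>0. \<forall>y :: nat \<Rightarrow> 'a.
           range y \<subseteq> ball 0 1 \<and> (SUP n. pseudohyperbolic_dist (x n) (y n)) < \<delta> \<longrightarrow>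
           bloch_interpolating y"
proof -
  obtain K where K: "0 \<le> K"
    and approx: "\<And>a. (\<And>n. cmod (a n) \<le> 1) \<Longrightarrow>
      \<exists>f. bloch_bound K f \<and> (\<forall>n. cmod (a n - weighted_radial_derivative f (x n)) \<le> 1/4)"
    using bloch_interpolating_approximation[OF assms] by blast
  have x: "x n \<in> ball 0 1" for n
    using assms unfolding bloch_interpolating_def by blast
  \<comment> \<open>The second term makes the perturbation \<open>84 * \<delta> * K\<close> at most \<open>1/4\<close>.\<close>
  define \<delta> where "\<delta> = min (1/16) (1 / (336 * (K + 1)))"
  have \<delta>: "0 < \<delta>" "\<delta> \<le> 1/16" using K by (auto simp: \<delta>_def)
  have "\<delta> \<le> 1 / (336 * (K + 1))" by (simp add: \<delta>_def)
  then have "\<delta> * (336 * (K + 1)) \<le> 1" using K by (simp add: field_simps)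
  then have \<delta>K: "84 * \<delta> * K \<le> 1/4" using \<delta> by (simp add: algebra_simps)
  show ?thesis
  proof (intro exI[of _ \<delta>] conjI allI impI)
    fix y :: "nat \<Rightarrow> 'a"
    assume *: "range y \<subseteq> ball 0 1 \<and> (SUP n. pseudohyperbolic_dist (x n) (y n)) < \<delta>"
    then have y: "y n \<in> ball 0 1" for n by blast
    have "bdd_above (range (\<lambda>n. pseudohyperbolic_dist (x n) (y n)))"
    proof (rule bdd_aboveI2)
      fix n
      have "0 \<le> (1 - (norm (x n))\<^sup>2) * (1 - (norm (y n))\<^sup>2) / (cmod (1 - cinner (x n) (y n)))\<^sup>2"
        using one_minus_norm_square_pos[OF x[of n]] one_minus_norm_square_pos[OF y[of n]] by simp
      then show "pseudohyperbolic_dist (x n) (y n) \<le> 1"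
        unfolding pseudohyperbolic_dist_def by simp
    qed
    then have close: "pseudohyperbolic_dist (x n) (y n) < \<delta>" for n
      using * by (meson UNIV_I cSUP_upper le_less_trans)
    have approx_y: "\<exists>f. bloch_bound K f \<and>
        (\<forall>n. cmod (a n - weighted_radial_derivative f (y n)) \<le> 1/2)"
      if a: "\<And>n. cmod (a n) \<le> 1" for a
    proof -
      obtain f where f: "bloch_bound K f"
        "\<And>n. cmod (a n - weighted_radial_derivative f (x n)) \<le> 1/4"
        using approx[of a] a by blast
      have "cmod (a n - weighted_radial_derivative f (y n)) \<le> 1/2" for n
      proof -
        have "cmod (a n - weighted_radial_derivative f (y n)) \<le> 1/4 + 84 * \<delta> * K"
          using norm_triangle_mono[OF f(2)[of n]
            weighted_radial_derivative_perturbation[OF f(1) K x y \<delta> close, of n]] by simp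
        then show ?thesis using \<delta>K by simp
      qed
      then show ?thesis using f(1) by blast
    qed
    have interp: "\<exists>M\<ge>0. \<exists>f. bloch_bound M f \<and> (\<forall>n. weighted_radial_derivative f (y n) = a n)"
      if "bounded (range a)" for a
      by (rule interpolation_by_successive_approximation[OF y K approx_y that])
    \<comment> \<open>The radial derivative vanishes at the origin, so a sequence through the origin
      could not interpolate the constant 1.\<close>
    have "y n \<noteq> 0" for n
    proof
      assume y0: "y n = 0"
      have "bounded (range (\<lambda>n::nat. 1 :: complex))" by (simp add: image_def)
      from interp[OF this] obtain M f where f: "bloch_bound M f"
        "weighted_radial_derivative f (y n) = 1" by blast
      have "frechet_derivative f (at (0::'a)) 0 = 0"
        using bloch_bound_derivative[OF f(1), of 0 0] by simp
      then show False
        using f(2) y0 by (simp add: weighted_radial_derivative_def radial_derivative_def)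
    qed
    then have "range y \<subseteq> ball 0 1 - {0}" using y by auto
    then show "bloch_interpolating y"
      unfolding bloch_interpolating_iff using interp by simp
  qed (rule \<delta>(1))
qed

end
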